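(* Let $l\ge 1$, let $m_1,\dots,m_l\ge 1$ be integers with $\sum_{j=1}^l m_j=d$, let $\vec p=(p_1,\dots,p_l)$ with $p_j\ge 1$, and let $\vec A=(A_1,\dots,A_l)$, where each $A_j:\mathbb{R}^{m_j}\to\mathbb{R}^{m_j}$ is a linear operator with $\det(A_j)\ne 0$. Then for every $f\in L_{\vec p}$, $$\bigl|V_{\vec A}[f]\bigr|_{\vec p}\;\le\;\Lambda_{\vec p}(\vec A)\,|f|_{\vec p},\qquad \Lambda_{\vec p}(\vec A)=\prod_{j=1}^l|\det A_j|^{-1/p_j},$$ and equality is attained if, for example, $f$ is factorable, i.e. $f(x)=\prod_{j=1}^l g_j(x_j)$ with $g_j\in L_{p_j}(\mathbb{R}^{m_j})$, $j=1,\dots,l$.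
   Context: Write $\mathbb{R}^d=\mathbb{R}^{m_1}\times\cdots\times\mathbb{R}^{m_l}$ with points $\vec x=(x_1,\dots,x_l)$, $x_j\in\mathbb{R}^{m_j}$, each $\mathbb{R}^{m_j}$ carrying Lebesgue measure. The anisotropic (mixed) Lebesgue space $L_{\vec p}$ consists of all measurable $f:\mathbb{R}^d\to\mathbb{R}$ with finite norm $$|f|_{\vec p}=\left(\int_{\mathbb{R}^{m_l}}dx_l\left(\int_{\mathbb{R}^{m_{l-1}}}dx_{l-1}\cdots\left(\int_{\mathbb{R}^{m_1}}|f(\vec x)|^{p_1}dx_1\right)^{p_2/p_1}\right)^{p_3/p_2}\cdots\right)^{1/p_l},$$ i.e. one takes successively the $L_{p_1}$ norm in $x_1$, then the $L_{p_2}$ norm in $x_2$, and so on up to the $L_{p_l}$ norm in $x_l$ (with the usual essential supremum, and $1/p_j=0$, if $p_j=\infty$). The tensor dilation operator is $V_{\vec A}[f](\vec x)=f(A_1x_1,A_2x_2,\dots,A_lx_l)$. *)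

theory Defs
  imports "HOL-Probability.Probability" "HOL-Probability.Essential_Supremum"
    "Jordan_Normal_Form.Determinant"
begin

text \<open>
  The number of blocks and the dimensions of the blocks vary, so they cannot be types.
  A vector of \<open>\<real>\<^sup>n\<close> is a function on \<open>{..<n}\<close> (with the value \<open>undefined\<close> elsewhere), i.e. an
  element of the space of \<open>\<Pi>\<^sub>M i\<in>{..<n}. lborel\<close>. A point of \<open>\<real>\<^sup>d\<close>, where \<open>d\<close> is the sum of the
  \<open>m j\<close> for \<open>j < l\<close>, is a function \<open>x\<close> on \<open>{..<l}\<close> with \<open>x j \<in> \<real>\<^bsup>m j\<^esup>\<close>. Blocks are numbered
  \<open>0, \<dots>, l - 1\<close>.
\<close>

definition Rn :: "nat \<Rightarrow> (nat \<Rightarrow> real) set" where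
  "Rn n = ({..<n} \<rightarrow>\<^sub>E UNIV)"

definition borel_Rn :: "nat \<Rightarrow> (nat \<Rightarrow> real) measure" where
  "borel_Rn n = (\<Pi>\<^sub>M i\<in>{..<n}. lborel)"

definition lebesgue_Rn :: "nat \<Rightarrow> (nat \<Rightarrow> real) measure" where
  "lebesgue_Rn n = completion (borel_Rn n)"

definition lebesgue_blocks :: "nat \<Rightarrow> (nat \<Rightarrow> nat) \<Rightarrow> (nat \<Rightarrow> nat \<Rightarrow> real) measure" where
  "lebesgue_blocks l m = completion (\<Pi>\<^sub>M j\<in>{..<l}. borel_Rn (m j))"

definition linear_operator :: "nat \<Rightarrow> ((nat \<Rightarrow> real) \<Rightarrow> (nat \<Rightarrow> real)) \<Rightarrow> bool" where
  "linear_operator n T \<longleftrightarrow>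
     T \<in> Rn n \<rightarrow> Rn n \<and>
     (\<forall>x\<in>Rn n. \<forall>y\<in>Rn n. T (\<lambda>i\<in>{..<n}. x i + y i) = (\<lambda>i\<in>{..<n}. T x i + T y i)) \<and>
     (\<forall>c. \<forall>x\<in>Rn n. T (\<lambda>i\<in>{..<n}. c * x i) = (\<lambda>i\<in>{..<n}. c * T x i))"

definition std_basis :: "nat \<Rightarrow> nat \<Rightarrow> nat \<Rightarrow> real" where
  "std_basis n k = (\<lambda>i\<in>{..<n}. if i = k then 1 else 0)"

definition det_operator :: "nat \<Rightarrow> ((nat \<Rightarrow> real) \<Rightarrow> (nat \<Rightarrow> real)) \<Rightarrow> real" where
  "det_operator n T = Determinant.det (Matrix.mat n n (\<lambda>(i, k). T (std_basis n k) i))"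

text \<open>Real powers of extended nonnegative numbers; used for exponents \<open>a > 0\<close> only.\<close>

definition epow :: "ennreal \<Rightarrow> real \<Rightarrow> ennreal" where
  "epow x a = (if x = \<infinity> then \<infinity> else ennreal (enn2real x powr a))"

text \<open>\<open>1 / p\<close>, with value \<open>0\<close> for \<open>p = \<infinity>\<close>.\<close>

definition recip :: "ennreal \<Rightarrow> real" where
  "recip p = enn2real (inverse p)"

text \<open>
  The norm takes values in \<open>[0, \<infinity>]\<close> and is applied to \<open>[0, \<infinity>]\<close>-valued functions, because the inner
  norms of an iterated norm may be infinite at some points.
\<close>

definition Lp_norm :: "'a measure \<Rightarrow> ennreal \<Rightarrow> ('a \<Rightarrow> ennreal) \<Rightarrow> ennreal" where
  "Lp_norm M p F =
     (if p = \<infinity> then esssup M F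
      else epow (\<integral>\<^sup>+ t. epow (F t) (enn2real p) \<partial>M) (recip p))"

definition Lp :: "nat \<Rightarrow> ennreal \<Rightarrow> ((nat \<Rightarrow> real) \<Rightarrow> real) set" where
  "Lp n p = {g \<in> borel_measurable (lebesgue_Rn n).
     Lp_norm (lebesgue_Rn n) p (\<lambda>t. ennreal \<bar>g t\<bar>) < \<infinity>}"

text \<open>
  \<open>iterated_norm m p f k x\<close> is the norm of \<open>f\<close> in the blocks \<open>0, \<dots>, k - 1\<close> (block \<open>0\<close> innermost)
  with the blocks of index \<open>\<ge> k\<close> frozen at their values in \<open>x\<close>. For \<open>k = l\<close> all blocks have been
  integrated out, so the start point in \<open>mixed_norm\<close> plays no role except for being undefined
  outside \<open>{..<l}\<close>.
\<close>

primrec iterated_norm ::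
  "(nat \<Rightarrow> nat) \<Rightarrow> (nat \<Rightarrow> ennreal) \<Rightarrow> ((nat \<Rightarrow> nat \<Rightarrow> real) \<Rightarrow> real) \<Rightarrow> nat
    \<Rightarrow> (nat \<Rightarrow> nat \<Rightarrow> real) \<Rightarrow> ennreal" where
  "iterated_norm m p f 0 x = ennreal \<bar>f x\<bar>"
| "iterated_norm m p f (Suc k) x =
     Lp_norm (lebesgue_Rn (m k)) (p k) (\<lambda>t. iterated_norm m p f k (x(k := t)))"

definition mixed_norm ::
  "nat \<Rightarrow> (nat \<Rightarrow> nat) \<Rightarrow> (nat \<Rightarrow> ennreal) \<Rightarrow> ((nat \<Rightarrow> nat \<Rightarrow> real) \<Rightarrow> real) \<Rightarrow> ennreal" where
  "mixed_norm l m p f = iterated_norm m p f l (\<lambda>_. undefined)"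

definition mixed_Lp ::
  "nat \<Rightarrow> (nat \<Rightarrow> nat) \<Rightarrow> (nat \<Rightarrow> ennreal) \<Rightarrow> ((nat \<Rightarrow> nat \<Rightarrow> real) \<Rightarrow> real) set" where
  "mixed_Lp l m p = {f \<in> borel_measurable (lebesgue_blocks l m). mixed_norm l m p f < \<infinity>}"

definition dilation ::
  "nat \<Rightarrow> (nat \<Rightarrow> (nat \<Rightarrow> real) \<Rightarrow> (nat \<Rightarrow> real)) \<Rightarrow> ((nat \<Rightarrow> nat \<Rightarrow> real) \<Rightarrow> real)
    \<Rightarrow> (nat \<Rightarrow> nat \<Rightarrow> real) \<Rightarrow> real" where
  "dilation l A f x = f (\<lambda>j\<in>{..<l}. A j (x j))"

definition dilation_const ::
  "nat \<Rightarrow> (nat \<Rightarrow> nat) \<Rightarrow> (nat \<Rightarrow> ennreal) \<Rightarrow> (nat \<Rightarrow> (nat \<Rightarrow> real) \<Rightarrow> (nat \<Rightarrow> real)) \<Rightarrow> real" where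
  "dilation_const l m p A = (\<Prod>j<l. \<bar>det_operator (m j) (A j)\<bar> powr (- recip (p j)))"

definition factorable ::
  "nat \<Rightarrow> (nat \<Rightarrow> nat) \<Rightarrow> (nat \<Rightarrow> ennreal) \<Rightarrow> ((nat \<Rightarrow> nat \<Rightarrow> real) \<Rightarrow> real) \<Rightarrow> bool" where
  "factorable l m p f \<longleftrightarrow>
     (\<exists>g. (\<forall>j<l. g j \<in> Lp (m j) (p j)) \<and>
          (\<forall>x\<in>(\<Pi>\<^sub>E j\<in>{..<l}. Rn (m j)). f x = (\<Prod>j<l. g j (x j))))"

end

theory Submission
  imports Defs
begin

text \<open>
  The norm inequality is an equality for every function: an invertible linear operator \<open>T\<close> is an
  automorphism of the Lebesgue measurable space that multiplies the measure by a constant, so the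
  lower integral \<open>nn_integral\<close> and \<open>esssup\<close> transform exactly, even for the slices of \<open>f\<close> that fail
  to be measurable. The substitution is then applied block by block. The scaling constant is found by
  induction on the dimension: an invertible matrix is, up to a row addition that makes the last
  diagonal entry nonzero, the product of a shear along the last coordinate and a matrix whose last
  column vanishes above the diagonal; Fubini's theorem handles both factors.
\<close>

section \<open>Measure-scaling automorphisms\<close>

lemma null_sets_scale_measure:
  assumes "c \<noteq> 0"
  shows "null_sets (scale_measure c M) = null_sets M"
  using assms by (auto simp: null_sets_def)

lemma completion_scale_measure:
  assumes "c \<noteq> 0"
  shows "completion (scale_measure c M) = scale_measure c (completion M)"
proof (rule measure_eqI)
  show "sets (completion (scale_measure c M)) = sets (scale_measure c (completion M))"
    by (simp add: sets_completion null_sets_scale_measure[OF assms])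
  fix X assume X: "X \<in> sets (completion (scale_measure c M))"
  \<comment> \<open>\<open>main_part\<close> is picked by Hilbert choice from a predicate that sees
    only the measurable sets and the null sets, so both measures pick the same set.\<close>
  have "main_part (scale_measure c M) X = main_part M X"
    by (simp add: main_part_def split_completion_def[abs_def] null_sets_scale_measure[OF assms])
  moreover have "X \<in> sets (completion M)"
    using X by (simp add: sets_completion null_sets_scale_measure[OF assms])
  ultimately show "emeasure (completion (scale_measure c M)) X
      = emeasure (scale_measure c (completion M)) X"
    using X by simp
qed

text \<open>The pushforward is a nonzero multiple of \<open>M\<close> and so has the same null sets.
  Hence \<open>T\<close> pulls null sets back to null sets, which is what measurability between the
  completions requires.\<close>

lemma completion_of_scaling_map:
  assumes T: "T \<in> M \<rightarrow>\<^sub>M M" and scal: "distr M M T = scale_measure c M" and c: "c \<noteq> 0"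
  shows "T \<in> completion M \<rightarrow>\<^sub>M completion M"
    and "distr (completion M) (completion M) T = scale_measure c (completion M)"
proof -
  have T': "T \<in> completion M \<rightarrow>\<^sub>M M"
    using T by (rule measurable_completion)
  have eq: "distr (completion M) M T = scale_measure c M"
    using distr_completion[OF T] scal by simp
  have null: "null_sets (distr (completion M) M T) = null_sets M"
    by (simp add: eq null_sets_scale_measure[OF c])
  show "T \<in> completion M \<rightarrow>\<^sub>M completion M"
    using T' null by (intro completion.measurable_completion2) auto
  show "distr (completion M) (completion M) T = scale_measure c (completion M)"
    using completion.completion_distr_eq[OF T' null] by (simp add: eq completion_scale_measure[OF c])
qed

text \<open>\<open>nn_integral\<close> is a supremum over simple functions below the integrand, so
  it makes sense for every \<open>F\<close>. Multiplying such a simple function by \<open>c\<close>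
  gives a measurable function below \<open>c * F\<close>.\<close>

lemma nn_integral_cmult_arbitrary_le:
  "ennreal c * (\<integral>\<^sup>+x. F x \<partial>M) \<le> (\<integral>\<^sup>+x. ennreal c * F x \<partial>M)"
proof -
  have "ennreal c * (\<integral>\<^sup>+x. F x \<partial>M)
      = (SUP g\<in>{g. simple_function M g \<and> g \<le> F}. ennreal c * integral\<^sup>S M g)"
    unfolding nn_integral_def by (simp add: SUP_mult_left_ennreal)
  also have "\<dots> \<le> (\<integral>\<^sup>+x. ennreal c * F x \<partial>M)"
  proof (rule SUP_least, clarify)
    fix g assume g: "simple_function M g" "g \<le> F"
    then have "ennreal c * integral\<^sup>S M g = (\<integral>\<^sup>+x. ennreal c * g x \<partial>M)"
      by (simp add: nn_integral_cmult borel_measurable_simple_function nn_integral_eq_simple_integral)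
    also have "\<dots> \<le> (\<integral>\<^sup>+x. ennreal c * F x \<partial>M)"
      using g by (intro nn_integral_mono mult_left_mono) (auto simp: le_fun_def)
    finally show "ennreal c * integral\<^sup>S M g \<le> (\<integral>\<^sup>+x. ennreal c * F x \<partial>M)" .
  qed
  finally show ?thesis .
qed

lemma ennreal_inverse_cancel:
  assumes "c > 0"
  shows "ennreal (1 / c) * (ennreal c * x) = x" "ennreal c * (ennreal (1 / c) * x) = x"
  using assms by (simp_all add: mult.assoc[symmetric] ennreal_mult[symmetric])

lemma ennreal_mult_le_iff_pos:
  assumes "c > 0"
  shows "ennreal c * x \<le> y \<longleftrightarrow> x \<le> ennreal (1 / c) * y"
  by (metis assms ennreal_inverse_cancel mult_left_mono zero_le)

text \<open>The reverse inequality is the one-sided bound for the factor \<open>1 / c\<close> and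
  the integrand \<open>c * F\<close>.\<close>

lemma nn_integral_cmult_arbitrary:
  assumes "c \<ge> 0"
  shows "(\<integral>\<^sup>+x. ennreal c * F x \<partial>M) = ennreal c * (\<integral>\<^sup>+x. F x \<partial>M)"
proof (cases "c = 0")
  case False
  with assms have c: "c > 0" by simp
  have "ennreal (1 / c) * (\<integral>\<^sup>+x. ennreal c * F x \<partial>M)
      \<le> (\<integral>\<^sup>+x. ennreal (1 / c) * (ennreal c * F x) \<partial>M)"
    by (rule nn_integral_cmult_arbitrary_le)
  then have "(\<integral>\<^sup>+x. ennreal c * F x \<partial>M) \<le> ennreal c * (\<integral>\<^sup>+x. F x \<partial>M)"
    using c by (simp add: ennreal_inverse_cancel ennreal_mult_le_iff_pos)
  then show ?thesis
    using nn_integral_cmult_arbitrary_le by (rule antisym)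
qed simp

text \<open>A simple \<open>g\<close> below \<open>F\<close> yields the measurable function
  \<open>g o T\<close> below \<open>F o T\<close>, whose integral is \<open>c\<close> times that of
  \<open>g\<close>. For arbitrary \<open>F\<close> this gives one direction; the other one will use
  an inverse of \<open>T\<close>.\<close>

lemma nn_integral_scaling_map_le:
  assumes T: "T \<in> N \<rightarrow>\<^sub>M N" and scal: "distr N N T = scale_measure (ennreal c) N"
  shows "ennreal c * (\<integral>\<^sup>+x. F x \<partial>N) \<le> (\<integral>\<^sup>+x. F (T x) \<partial>N)"
proof -
  have "ennreal c * (\<integral>\<^sup>+x. F x \<partial>N)
      = (SUP g\<in>{g. simple_function N g \<and> g \<le> F}. ennreal c * integral\<^sup>S N g)"
    unfolding nn_integral_def by (simp add: SUP_mult_left_ennreal)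
  also have "\<dots> \<le> (\<integral>\<^sup>+x. F (T x) \<partial>N)"
  proof (rule SUP_least, clarify)
    fix g assume g: "simple_function N g" "g \<le> F"
    have [measurable]: "g \<in> borel_measurable N"
      using g by (simp add: borel_measurable_simple_function)
    have "ennreal c * integral\<^sup>S N g = (\<integral>\<^sup>+x. g x \<partial>scale_measure (ennreal c) N)"
      using g by (simp add: nn_integral_scale_measure nn_integral_eq_simple_integral)
    also have "\<dots> = (\<integral>\<^sup>+x. g (T x) \<partial>N)"
      using T by (simp flip: scal add: nn_integral_distr)
    also have "\<dots> \<le> (\<integral>\<^sup>+x. F (T x) \<partial>N)"
      using g by (intro nn_integral_mono) (auto simp: le_fun_def)
    finally show "ennreal c * integral\<^sup>S N g \<le> (\<integral>\<^sup>+x. F (T x) \<partial>N)" .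
  qed
  finally show ?thesis .
qed

text \<open>The set where \<open>F\<close> exceeds its essential supremum is null, hence null for
  the pushforward, hence its preimage is null. For nonmeasurable \<open>F\<close> the right side is
  the top element.\<close>

lemma esssup_comp_le:
  assumes T: "T \<in> N \<rightarrow>\<^sub>M N" and scal: "distr N N T = scale_measure c N"
  shows "esssup N (\<lambda>x. F (T x)) \<le> esssup N F"
proof (cases "F \<in> borel_measurable N")
  case True
  note [measurable] = True T
  have "emeasure (scale_measure c N) {x \<in> space N. F x > esssup N F} = 0"
    by (simp add: esssup_zero_measure)
  then have "emeasure N (T -` {x \<in> space N. F x > esssup N F} \<inter> space N) = 0"
    by (simp flip: scal add: emeasure_distr)
  then have "AE x in N. F (T x) \<le> esssup N F"
    by (rule AE_I[rotated]) (use measurable_space[OF T] in \<open>auto simp: not_le\<close>)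
  then show ?thesis
    by (intro esssup_I) auto
qed (simp add: esssup_non_measurable)

lemma esssup_cong_space:
  assumes "\<And>x. x \<in> space M \<Longrightarrow> f x = g x"
  shows "esssup M f = esssup M g"
proof -
  have "f \<in> borel_measurable M \<longleftrightarrow> g \<in> borel_measurable M"
    using assms by (rule measurable_cong)
  moreover have "AE x in M. f x = g x"
    using assms by (rule AE_I2)
  ultimately show ?thesis
    by (cases "f \<in> borel_measurable M") (auto simp: esssup_non_measurable intro: esssup_AE_cong)
qed

text \<open>Pulling a set back along \<open>S\<close> and then along \<open>T\<close> returns it, so
  the scaling of \<open>T\<close> is evaluated on preimages under \<open>S\<close>.\<close>

lemma scaling_map_inverse:
  assumes T: "T \<in> N \<rightarrow>\<^sub>M N" and S: "S \<in> N \<rightarrow>\<^sub>M N"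
    and inv: "\<And>x. x \<in> space N \<Longrightarrow> S (T x) = x"
    and scal: "distr N N T = scale_measure (ennreal c) N" and c: "c > 0"
  shows "distr N N S = scale_measure (ennreal (1 / c)) N"
proof (rule measure_eqI)
  fix X assume "X \<in> sets (distr N N S)"
  then have X: "X \<in> sets N" by simp
  have "T -` (S -` X \<inter> space N) \<inter> space N = X"
    using inv sets.sets_into_space[OF X] measurable_space[OF T] by auto
  then have "emeasure N X = emeasure (distr N N T) (S -` X \<inter> space N)"
    using T S X by (simp add: emeasure_distr)
  also have "\<dots> = ennreal c * emeasure (distr N N S) X"
    using S X by (simp add: scal emeasure_distr)
  finally show "emeasure (distr N N S) X = emeasure (scale_measure (ennreal (1 / c)) N) X"
    using c by (simp add: ennreal_inverse_cancel)
qed simp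

context
  fixes N :: "'a measure" and T S :: "'a \<Rightarrow> 'a" and c :: real
  assumes T: "T \<in> N \<rightarrow>\<^sub>M N" and S: "S \<in> N \<rightarrow>\<^sub>M N"
    and ST: "\<And>x. x \<in> space N \<Longrightarrow> S (T x) = x" and TS: "\<And>x. x \<in> space N \<Longrightarrow> T (S x) = x"
    and scal: "distr N N T = scale_measure (ennreal c) N" and c: "c > 0"
begin

text \<open>The missing inequality is the one-sided bound for \<open>S\<close>, which scales by
  \<open>1 / c\<close>, applied to \<open>F o T\<close>. The equality thus covers nonmeasurable
  \<open>F\<close> as well.\<close>

lemma nn_integral_scaling_map:
  "(\<integral>\<^sup>+x. F (T x) \<partial>N) = ennreal c * (\<integral>\<^sup>+x. F x \<partial>N)"
proof (rule antisym)
  have "ennreal (1 / c) * (\<integral>\<^sup>+x. F (T x) \<partial>N) \<le> (\<integral>\<^sup>+x. F (T (S x)) \<partial>N)"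
    using S scaling_map_inverse[OF T S ST scal c] by (rule nn_integral_scaling_map_le)
  also have "\<dots> = (\<integral>\<^sup>+x. F x \<partial>N)"
    by (intro nn_integral_cong) (simp add: TS)
  finally show "(\<integral>\<^sup>+x. F (T x) \<partial>N) \<le> ennreal c * (\<integral>\<^sup>+x. F x \<partial>N)"
    using c by (simp add: ennreal_mult_le_iff_pos)
qed (use T scal in \<open>rule nn_integral_scaling_map_le\<close>)

lemma esssup_scaling_map: "esssup N (\<lambda>x. F (T x)) = esssup N F"
proof (rule antisym)
  have "esssup N F = esssup N (\<lambda>x. F (T (S x)))"
    by (rule esssup_cong_space) (simp add: TS)
  also have "\<dots> \<le> esssup N (\<lambda>x. F (T x))"
    using S scaling_map_inverse[OF T S ST scal c] by (rule esssup_comp_le)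
  finally show "esssup N F \<le> esssup N (\<lambda>x. F (T x))" .
qed (use T scal in \<open>rule esssup_comp_le\<close>)

end

section \<open>The \<open>Lp_norm\<close> under scalar factors and scaling maps\<close>

lemma epow_mult:
  assumes "c \<ge> 0" "a > 0"
  shows "epow (ennreal c * x) a = ennreal (c powr a) * epow x a"
proof (cases "c = 0")
  case False
  then show ?thesis
    using assms
    by (cases x) (auto simp: epow_def ennreal_mult_eq_top_iff enn2real_mult powr_mult ennreal_mult)
qed (use assms in \<open>simp add: epow_def\<close>)

lemma finite_exponent:
  assumes "p \<ge> 1" "p \<noteq> \<infinity>"
  shows "enn2real p \<ge> 1" "recip p = 1 / enn2real p" "recip p > 0"
  using assms
  by (cases p; auto simp: recip_def inverse_ennreal ennreal_le_iff2 one_ennreal.rep_eq inverse_eq_divide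
      simp flip: ennreal_1)+

lemma esssup_cmult_le:
  assumes "c > 0"
  shows "esssup M (\<lambda>x. ennreal c * F x) \<le> ennreal c * esssup M F"
proof (cases "F \<in> borel_measurable M")
  case True
  then show ?thesis
    using esssup_AE[of F M] by (intro esssup_I) (auto elim!: eventually_mono intro: mult_left_mono)
\<comment> \<open>For nonmeasurable \<open>F\<close> the bound is \<open>c\<close> times top, which
  is top because \<open>c > 0\<close>.\<close>
qed (use assms in \<open>simp add: esssup_non_measurable ennreal_mult_top\<close>)

lemma esssup_cmult_ennreal:
  fixes F :: "'a \<Rightarrow> ennreal"
  assumes "c \<ge> 0"
  shows "esssup M (\<lambda>x. ennreal c * F x) = ennreal c * esssup M F"
proof (cases "c = 0")
  case True
  have "esssup M (\<lambda>x. 0 :: ennreal) \<le> 0"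
    by (rule esssup_I) auto
  with True show ?thesis by simp
next
  case False
  with assms have c: "c > 0" by simp
  have "esssup M (\<lambda>x. ennreal (1 / c) * (ennreal c * F x))
      \<le> ennreal (1 / c) * esssup M (\<lambda>x. ennreal c * F x)"
    using c by (intro esssup_cmult_le) simp
  then have "ennreal c * esssup M F \<le> esssup M (\<lambda>x. ennreal c * F x)"
    using c by (simp add: ennreal_inverse_cancel ennreal_mult_le_iff_pos)
  with esssup_cmult_le[OF c] show ?thesis by (rule antisym)
qed

text \<open>The factor passes through power, integral and root as
  \<open>(c powr p) powr (1 / p) = c\<close>. \<open>F\<close> is arbitrary because it will be an
  inner norm of an iterated norm, whose measurability is not established.\<close>

lemma Lp_norm_cmult:
  assumes "c \<ge> 0" "p \<ge> 1"
  shows "Lp_norm M p (\<lambda>t. ennreal c * F t) = ennreal c * Lp_norm M p F"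
proof (cases "p = \<infinity>")
  case False
  have p: "enn2real p > 0" "enn2real p \<noteq> 0" "recip p = 1 / enn2real p" "recip p > 0"
    using finite_exponent[OF assms(2) False] by auto
  have "(c powr enn2real p) powr recip p = c"
    using p assms by (simp add: powr_powr)
  then show ?thesis
    using False p assms
    by (simp add: Lp_norm_def epow_mult nn_integral_cmult_arbitrary)
qed (use assms in \<open>simp add: Lp_norm_def esssup_cmult_ennreal\<close>)

text \<open>The integral gains the factor \<open>c\<close>, and the outer root turns it into
  \<open>c powr recip p\<close>. For \<open>p = \<infinity>\<close> the essential supremum is
  invariant, in accordance with \<open>c powr 0 = 1\<close>.\<close>

lemma Lp_norm_scaling_map:
  assumes "T \<in> N \<rightarrow>\<^sub>M N" "S \<in> N \<rightarrow>\<^sub>M N"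
    and "\<And>x. x \<in> space N \<Longrightarrow> S (T x) = x" "\<And>x. x \<in> space N \<Longrightarrow> T (S x) = x"
    and "distr N N T = scale_measure (ennreal c) N" "c > 0" and p: "p \<ge> 1"
  shows "Lp_norm N p (\<lambda>t. F (T t)) = ennreal (c powr recip p) * Lp_norm N p F"
proof (cases "p = \<infinity>")
  case True
  with assms(6) show ?thesis
    by (simp add: Lp_norm_def esssup_scaling_map[OF assms(1-6)] recip_def)
next
  case False
  with p finite_exponent[OF p False] assms(6) show ?thesis
    by (simp add: Lp_norm_def nn_integral_scaling_map[OF assms(1-6), of "\<lambda>t. epow (F t) (enn2real p)"] epow_mult)
qed

lemma Lp_norm_cong_space:
  assumes "\<And>x. x \<in> space M \<Longrightarrow> F x = G x"
  shows "Lp_norm M p F = Lp_norm M p G"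
proof -
  have "(\<integral>\<^sup>+ t. epow (F t) (enn2real p) \<partial>M) = (\<integral>\<^sup>+ t. epow (G t) (enn2real p) \<partial>M)"
    using assms by (intro nn_integral_cong) simp
  moreover have "esssup M F = esssup M G"
    using assms by (rule esssup_cong_space)
  ultimately show ?thesis
    by (simp add: Lp_norm_def)
qed

section \<open>The linear change of variables\<close>

definition mat_apply :: "nat \<Rightarrow> real mat \<Rightarrow> (nat \<Rightarrow> real) \<Rightarrow> nat \<Rightarrow> real" where
  "mat_apply n A x = (\<lambda>i\<in>{..<n}. \<Sum>k<n. A $$ (i, k) * x k)"

lemma space_borel_Rn: "space (borel_Rn n) = Rn n"
  by (simp add: borel_Rn_def Rn_def space_PiM)

lemma mat_apply_measurable: "mat_apply n A \<in> borel_Rn n \<rightarrow>\<^sub>M borel_Rn n"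
  unfolding borel_Rn_def mat_apply_def by (intro measurable_restrict) measurable

lemma mat_apply_in_Rn: "mat_apply n A x \<in> Rn n"
  by (auto simp: mat_apply_def Rn_def)

lemma mat_apply_mult:
  assumes "A \<in> carrier_mat n n" "B \<in> carrier_mat n n"
  shows "mat_apply n (A * B) x = mat_apply n A (mat_apply n B x)"
proof
  fix i
  show "mat_apply n (A * B) x i = mat_apply n A (mat_apply n B x) i"
  proof (cases "i < n")
    case True
    have "(\<Sum>k<n. (A * B) $$ (i, k) * x k) = (\<Sum>k<n. \<Sum>j<n. A $$ (i, j) * B $$ (j, k) * x k)"
      using True assms
      by (intro sum.cong) (auto simp: scalar_prod_def sum_distrib_right lessThan_atLeast0)
    also have "\<dots> = (\<Sum>j<n. \<Sum>k<n. A $$ (i, j) * B $$ (j, k) * x k)"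
      by (rule sum.swap)
    finally show ?thesis
      using True by (simp add: mat_apply_def sum_distrib_left mult.assoc)
  qed (simp add: mat_apply_def)
qed

lemma mat_apply_one:
  assumes "x \<in> Rn n"
  shows "mat_apply n (1\<^sub>m n) x = x"
proof
  fix i
  have "(\<Sum>k<n. 1\<^sub>m n $$ (i, k) * x k) = x i" if "i < n"
  proof -
    have "(\<Sum>k<n. 1\<^sub>m n $$ (i, k) * x k) = (\<Sum>k<n. if k = i then x k else 0)"
      using that by (intro sum.cong) auto
    then show ?thesis using that by simp
  qed
  then show "mat_apply n (1\<^sub>m n) x i = x i"
    using assms by (auto simp: mat_apply_def Rn_def PiE_def extensional_def)
qed

section \<open>Fubini in the last coordinate, and scaling of the measure by matrices\<close>

interpretation lborel_prod: product_sigma_finite "\<lambda>_ :: nat. lborel :: real measure"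
  by standard

lemma borel_Rn_Suc: "borel_Rn (Suc n) = (\<Pi>\<^sub>M i\<in>insert n {..<n}. lborel)"
  by (simp add: borel_Rn_def lessThan_Suc)

lemma fun_upd_measurable_borel_Rn:
  "(\<lambda>(x, t). x(n := t)) \<in> borel_Rn n \<Otimes>\<^sub>M lborel \<rightarrow>\<^sub>M borel_Rn (Suc n)"
  unfolding borel_Rn_Suc unfolding borel_Rn_def by (rule measurable_add_dim)

text \<open>Both orders of integration are recorded: the last coordinate is innermost for
  translations and for matrices whose last column vanishes above the diagonal, and outermost for
  shears.\<close>

lemma nn_integral_borel_Rn_Suc:
  assumes F: "F \<in> borel_measurable (borel_Rn (Suc n))"
  shows "(\<integral>\<^sup>+x. F x \<partial>borel_Rn (Suc n)) = (\<integral>\<^sup>+x. (\<integral>\<^sup>+t. F (x(n := t)) \<partial>lborel) \<partial>borel_Rn n)"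
    and "(\<integral>\<^sup>+x. F x \<partial>borel_Rn (Suc n)) = (\<integral>\<^sup>+t. (\<integral>\<^sup>+x. F (x(n := t)) \<partial>borel_Rn n) \<partial>lborel)"
  using F unfolding borel_Rn_Suc unfolding borel_Rn_def
  by (intro lborel_prod.product_nn_integral_insert lborel_prod.product_nn_integral_insert_rev; simp)+

lemma borel_measurable_fun_upd_borel_Rn:
  assumes F: "F \<in> borel_measurable (borel_Rn (Suc n))"
  shows "(\<lambda>(x, t). F (x(n := t))) \<in> borel_measurable (borel_Rn n \<Otimes>\<^sub>M lborel)"
    and "x \<in> space (borel_Rn n) \<Longrightarrow> (\<lambda>t. F (x(n := t))) \<in> borel_measurable borel"
    and "(\<lambda>x. F (x(n := t))) \<in> borel_measurable (borel_Rn n)"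
    and "(\<lambda>x. \<integral>\<^sup>+t. F (x(n := t)) \<partial>lborel) \<in> borel_measurable (borel_Rn n)"
proof -
  show *: "(\<lambda>(x, t). F (x(n := t))) \<in> borel_measurable (borel_Rn n \<Otimes>\<^sub>M lborel)"
    using measurable_compose[OF fun_upd_measurable_borel_Rn F] by (simp add: case_prod_beta')
  show "(\<lambda>t. F (x(n := t))) \<in> borel_measurable borel" if "x \<in> space (borel_Rn n)"
    using measurable_compose[OF measurable_Pair1'[OF that, of lborel] *] by simp
  show "(\<lambda>x. F (x(n := t))) \<in> borel_measurable (borel_Rn n)"
    using measurable_compose[OF measurable_Pair2'[of t lborel "borel_Rn n"] *] by simp
  show "(\<lambda>x. \<integral>\<^sup>+t. F (x(n := t)) \<partial>lborel) \<in> borel_measurable (borel_Rn n)"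
    using * by (rule lborel.borel_measurable_nn_integral)
qed

text \<open>One-dimensional translation invariance removes the shift of the last coordinate; the
  inner integral is then a measurable function of the other coordinates, to which the induction
  hypothesis applies.\<close>

lemma nn_integral_borel_Rn_translate:
  "F \<in> borel_measurable (borel_Rn n) \<Longrightarrow>
    (\<integral>\<^sup>+x. F (\<lambda>i\<in>{..<n}. x i + v i) \<partial>borel_Rn n) = (\<integral>\<^sup>+x. F x \<partial>borel_Rn n)"
proof (induction n arbitrary: F)
  case 0
  show ?case
    by (rule nn_integral_cong) (auto simp: space_borel_Rn Rn_def intro: arg_cong[where f = F])
next
  case (Suc n)
  have tr: "(\<lambda>x. \<lambda>i\<in>{..<k}. x i + v i) \<in> borel_Rn k \<rightarrow>\<^sub>M borel_Rn k" for k
    unfolding borel_Rn_def by (intro measurable_restrict) measurable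
  \<comment> \<open>The form \<open>v n + 1 * t\<close> matches the affine substitution rule with
    slope 1.\<close>
  have upd: "(\<lambda>i\<in>{..<Suc n}. (x(n := t)) i + v i) = (\<lambda>i\<in>{..<n}. x i + v i)(n := v n + 1 * t)" for x t
    by (auto simp: fun_eq_iff)
  have "(\<integral>\<^sup>+x. F (\<lambda>i\<in>{..<Suc n}. x i + v i) \<partial>borel_Rn (Suc n))
      = (\<integral>\<^sup>+x. (\<integral>\<^sup>+t. F ((\<lambda>i\<in>{..<n}. x i + v i)(n := v n + 1 * t)) \<partial>lborel) \<partial>borel_Rn n)"
    using measurable_compose[OF tr Suc.prems] by (simp only: nn_integral_borel_Rn_Suc upd)
  also have "\<dots> = (\<integral>\<^sup>+x. (\<integral>\<^sup>+t. F ((\<lambda>i\<in>{..<n}. x i + v i)(n := t)) \<partial>lborel) \<partial>borel_Rn n)"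
  proof (rule nn_integral_cong)
    fix x assume x: "x \<in> space (borel_Rn n)"
    show "(\<integral>\<^sup>+t. F ((\<lambda>i\<in>{..<n}. x i + v i)(n := v n + 1 * t)) \<partial>lborel)
        = (\<integral>\<^sup>+t. F ((\<lambda>i\<in>{..<n}. x i + v i)(n := t)) \<partial>lborel)"
      using nn_integral_real_affine[OF borel_measurable_fun_upd_borel_Rn(2)
          [OF Suc.prems measurable_space[OF tr x]], where c = 1 and t = "v n"]
      by (simp only: abs_one ennreal_1 mult_1_left)
  qed
  also have "\<dots> = (\<integral>\<^sup>+x. (\<integral>\<^sup>+t. F (x(n := t)) \<partial>lborel) \<partial>borel_Rn n)"
    by (rule Suc.IH[OF borel_measurable_fun_upd_borel_Rn(4)[OF Suc.prems]])
  finally show ?case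
    by (simp only: nn_integral_borel_Rn_Suc[OF Suc.prems])
qed

text \<open>The change of variables formula, with the determinant on the left so that no division
  occurs and products of matrices compose directly. Stating it for functions rather than sets lets
  \<open>F\<close> absorb a further map.\<close>

definition mat_scales :: "nat \<Rightarrow> real mat \<Rightarrow> bool" where
  "mat_scales n A \<longleftrightarrow> (\<forall>F \<in> borel_measurable (borel_Rn n).
     ennreal \<bar>Determinant.det A\<bar> * (\<integral>\<^sup>+x. F (mat_apply n A x) \<partial>borel_Rn n) = (\<integral>\<^sup>+x. F x \<partial>borel_Rn n))"

lemma mat_scales_mult:
  assumes A: "A \<in> carrier_mat n n" and B: "B \<in> carrier_mat n n"
    and "mat_scales n A" "mat_scales n B"
  shows "mat_scales n (A * B)"
  unfolding mat_scales_def
proof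
  fix F :: "_ \<Rightarrow> ennreal"
  assume F: "F \<in> borel_measurable (borel_Rn n)"
  have "ennreal \<bar>Determinant.det (A * B)\<bar> * (\<integral>\<^sup>+x. F (mat_apply n (A * B) x) \<partial>borel_Rn n)
      = ennreal \<bar>Determinant.det A\<bar> * (ennreal \<bar>Determinant.det B\<bar> *
          (\<integral>\<^sup>+x. F (mat_apply n A (mat_apply n B x)) \<partial>borel_Rn n))"
    by (simp add: det_mult[OF A B] mat_apply_mult[OF A B] abs_mult ennreal_mult mult.assoc)
  also have "\<dots> = ennreal \<bar>Determinant.det A\<bar> * (\<integral>\<^sup>+x. F (mat_apply n A x) \<partial>borel_Rn n)"
    using bspec[OF assms(4)[unfolded mat_scales_def] measurable_compose[OF mat_apply_measurable F]]
    by simp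
  also have "\<dots> = (\<integral>\<^sup>+x. F x \<partial>borel_Rn n)"
    using assms(3) F by (auto simp: mat_scales_def)
  finally show "ennreal \<bar>Determinant.det (A * B)\<bar> * (\<integral>\<^sup>+x. F (mat_apply n (A * B) x) \<partial>borel_Rn n)
      = (\<integral>\<^sup>+x. F x \<partial>borel_Rn n)" .
qed

text \<open>Laplace expansion along the last column leaves a single term, with sign
  \<open>(-1)^(n + n) = 1\<close>.\<close>

lemma det_last_column_zero:
  assumes A: "A \<in> carrier_mat (Suc n) (Suc n)" and zero: "\<And>i. i < n \<Longrightarrow> A $$ (i, n) = 0"
  shows "Determinant.det A = A $$ (n, n) * Determinant.det (mat_delete A n n)"
  using laplace_expansion_column[OF A, of n] zero by (simp add: cofactor_def)

text \<open>For frozen \<open>x\<close>, the last coordinate \<open>t\<close> enters only the last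
  component of the image, affinely with slope \<open>a\<close> and offset \<open>u x\<close>. The
  inner integral therefore absorbs the factor \<open>a\<close> up to sign, and the leading block
  accounts for the rest of the determinant.\<close>

lemma mat_scales_lower:
  assumes A: "A \<in> carrier_mat (Suc n) (Suc n)" and zero: "\<And>i. i < n \<Longrightarrow> A $$ (i, n) = 0"
    and pivot: "A $$ (n, n) \<noteq> 0" and scales: "mat_scales n (mat_delete A n n)"
  shows "mat_scales (Suc n) A"
  unfolding mat_scales_def
proof
  fix F :: "_ \<Rightarrow> ennreal"
  assume F: "F \<in> borel_measurable (borel_Rn (Suc n))"
  define S where "S = mat_delete A n n"
  define a where "a = A $$ (n, n)"
  define u where "u x = (\<Sum>k<n. A $$ (n, k) * x k)" for x
  have S: "S $$ (i, k) = A $$ (i, k)" if "i < n" "k < n" for i k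
    using that A by (simp add: S_def mat_delete_def)
  have upd: "mat_apply (Suc n) A (x(n := t)) = (mat_apply n S x)(n := u x + a * t)" for x t
    using zero by (auto simp: fun_eq_iff mat_apply_def u_def a_def S less_Suc_eq)
  have "ennreal \<bar>a\<bar> * (\<integral>\<^sup>+x. F (mat_apply (Suc n) A x) \<partial>borel_Rn (Suc n))
      = ennreal \<bar>a\<bar> * (\<integral>\<^sup>+x. (\<integral>\<^sup>+t. F (mat_apply (Suc n) A (x(n := t))) \<partial>lborel) \<partial>borel_Rn n)"
    by (subst nn_integral_borel_Rn_Suc(1)[OF measurable_compose[OF mat_apply_measurable F]]) simp
  also have "\<dots> = (\<integral>\<^sup>+x. ennreal \<bar>a\<bar> *
      (\<integral>\<^sup>+t. F (mat_apply (Suc n) A (x(n := t))) \<partial>lborel) \<partial>borel_Rn n)"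
    by (intro nn_integral_cmult[symmetric] borel_measurable_fun_upd_borel_Rn(4)
        measurable_compose[OF mat_apply_measurable F])
  also have "\<dots> = (\<integral>\<^sup>+x. (\<integral>\<^sup>+t. F ((mat_apply n S x)(n := t)) \<partial>lborel) \<partial>borel_Rn n)"
  proof (rule nn_integral_cong)
    fix x assume x: "x \<in> space (borel_Rn n)"
    show "ennreal \<bar>a\<bar> * (\<integral>\<^sup>+t. F (mat_apply (Suc n) A (x(n := t))) \<partial>lborel)
        = (\<integral>\<^sup>+t. F ((mat_apply n S x)(n := t)) \<partial>lborel)"
      unfolding upd
      using nn_integral_real_affine[OF borel_measurable_fun_upd_borel_Rn(2)
          [OF F measurable_space[OF mat_apply_measurable x]], where c = a and t = "u x"] pivot
      by (simp add: a_def)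
  qed
  finally have a: "ennreal \<bar>a\<bar> * (\<integral>\<^sup>+x. F (mat_apply (Suc n) A x) \<partial>borel_Rn (Suc n))
      = (\<integral>\<^sup>+x. (\<integral>\<^sup>+t. F ((mat_apply n S x)(n := t)) \<partial>lborel) \<partial>borel_Rn n)" .
  have "ennreal \<bar>Determinant.det A\<bar> * (\<integral>\<^sup>+x. F (mat_apply (Suc n) A x) \<partial>borel_Rn (Suc n))
      = ennreal \<bar>Determinant.det S\<bar> *
        (\<integral>\<^sup>+x. (\<integral>\<^sup>+t. F ((mat_apply n S x)(n := t)) \<partial>lborel) \<partial>borel_Rn n)"
    by (simp add: det_last_column_zero[OF A zero] abs_mult ennreal_mult mult.assoc
        mult.left_commute[of "ennreal \<bar>a\<bar>"] a flip: S_def a_def)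
  also have "\<dots> = (\<integral>\<^sup>+x. (\<integral>\<^sup>+t. F (x(n := t)) \<partial>lborel) \<partial>borel_Rn n)"
    using scales borel_measurable_fun_upd_borel_Rn(4)[OF F] unfolding mat_scales_def S_def
    by (rule bspec)
  finally show "ennreal \<bar>Determinant.det A\<bar> * (\<integral>\<^sup>+x. F (mat_apply (Suc n) A x) \<partial>borel_Rn (Suc n))
      = (\<integral>\<^sup>+x. F x \<partial>borel_Rn (Suc n))"
    by (simp only: nn_integral_borel_Rn_Suc(1)[OF F])
qed

definition shear_mat :: "nat \<Rightarrow> (nat \<Rightarrow> real) \<Rightarrow> real mat" where
  "shear_mat n b = Matrix.mat (Suc n) (Suc n)
     (\<lambda>(i, k). if i = k then 1 else if k = n then b i else 0)"

lemma shear_mat_carrier: "shear_mat n b \<in> carrier_mat (Suc n) (Suc n)"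
  by (simp add: shear_mat_def)

lemma det_shear_mat: "Determinant.det (shear_mat n b) = 1"
proof -
  have "upper_triangular (shear_mat n b)"
    by (auto simp: shear_mat_def upper_triangular_def)
  moreover have "diag_mat (shear_mat n b) = map (\<lambda>_. 1) [0..<Suc n]"
    unfolding diag_mat_def by (intro map_cong) (auto simp: shear_mat_def)
  ultimately show ?thesis
    using det_upper_triangular[OF _ shear_mat_carrier] by (simp add: map_replicate_const)
qed

text \<open>With the last coordinate \<open>t\<close> outermost and fixed, the shear translates the
  other coordinates by \<open>b i * t\<close>, so translation invariance suffices.\<close>

lemma mat_scales_shear: "mat_scales (Suc n) (shear_mat n b)"
  unfolding mat_scales_def
proof
  fix F :: "_ \<Rightarrow> ennreal"
  assume F: "F \<in> borel_measurable (borel_Rn (Suc n))"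
  have upd: "mat_apply (Suc n) (shear_mat n b) (x(n := t)) = (\<lambda>i\<in>{..<n}. x i + b i * t)(n := t)" for x t
  proof
    fix i
    have "(\<Sum>k<n. shear_mat n b $$ (i, k) * x k) = (\<Sum>k<n. if k = i then x k else 0)" if "i \<le> n"
      using that by (intro sum.cong) (auto simp: shear_mat_def)
    then show "mat_apply (Suc n) (shear_mat n b) (x(n := t)) i = ((\<lambda>i\<in>{..<n}. x i + b i * t)(n := t)) i"
      by (auto simp: mat_apply_def less_Suc_eq_le) (auto simp: shear_mat_def)
  qed
  have "(\<integral>\<^sup>+x. F (mat_apply (Suc n) (shear_mat n b) x) \<partial>borel_Rn (Suc n))
      = (\<integral>\<^sup>+t. (\<integral>\<^sup>+x. F ((\<lambda>i\<in>{..<n}. x i + b i * t)(n := t)) \<partial>borel_Rn n) \<partial>lborel)"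
    by (subst nn_integral_borel_Rn_Suc(2)[OF measurable_compose[OF mat_apply_measurable F]])
      (simp only: upd)
  also have "\<dots> = (\<integral>\<^sup>+t. (\<integral>\<^sup>+x. F (x(n := t)) \<partial>borel_Rn n) \<partial>lborel)"
    by (intro nn_integral_cong nn_integral_borel_Rn_translate borel_measurable_fun_upd_borel_Rn(3)[OF F])
  finally show "ennreal \<bar>Determinant.det (shear_mat n b)\<bar> *
      (\<integral>\<^sup>+x. F (mat_apply (Suc n) (shear_mat n b) x) \<partial>borel_Rn (Suc n))
      = (\<integral>\<^sup>+x. F x \<partial>borel_Rn (Suc n))"
    by (simp add: det_shear_mat nn_integral_borel_Rn_Suc(2)[OF F])
qed

text \<open>One step of Gaussian elimination: with a nonzero pivot, subtracting multiples of the
  last row clears the last column above it, so \<open>A\<close> is a shear times a matrix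
  \<open>L\<close> covered by \<open>mat_scales_lower\<close>. The induction hypothesis is an
  explicit premise because the induction applies this lemma to several matrices.\<close>

lemma mat_scales_Suc_pivot:
  assumes IH: "\<And>B. B \<in> carrier_mat n n \<Longrightarrow> Determinant.det B \<noteq> 0 \<Longrightarrow> mat_scales n B"
    and A: "A \<in> carrier_mat (Suc n) (Suc n)" and det: "Determinant.det A \<noteq> 0"
    and pivot: "A $$ (n, n) \<noteq> 0"
  shows "mat_scales (Suc n) A"
proof -
  \<comment> \<open>The multiplier that makes the entry \<open>(i, n)\<close> of \<open>L\<close>
    vanish.\<close>
  define b where "b i = A $$ (i, n) / A $$ (n, n)" for i
  define L where "L = Matrix.mat (Suc n) (Suc n)
    (\<lambda>(i, k). if i < n then A $$ (i, k) - b i * A $$ (n, k) else A $$ (n, k))"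
  have L: "L \<in> carrier_mat (Suc n) (Suc n)"
    by (simp add: L_def)
  have A_eq: "A = shear_mat n b * L"
  proof (rule eq_matI)
    fix i k assume "i < dim_row (shear_mat n b * L)" "k < dim_col (shear_mat n b * L)"
    then have ik: "i < Suc n" "k < Suc n"
      by (simp_all add: shear_mat_def L_def)
    have "(\<Sum>j<n. shear_mat n b $$ (i, j) * L $$ (j, k)) = (\<Sum>j<n. if j = i then L $$ (j, k) else 0)"
      using ik by (intro sum.cong) (auto simp: shear_mat_def)
    moreover have "(shear_mat n b * L) $$ (i, k)
        = (\<Sum>j<n. shear_mat n b $$ (i, j) * L $$ (j, k)) + shear_mat n b $$ (i, n) * L $$ (n, k)"
      using ik shear_mat_carrier[of n b] L by (simp add: scalar_prod_def flip: lessThan_atLeast0)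
    ultimately show "A $$ (i, k) = (shear_mat n b * L) $$ (i, k)"
      using ik by (auto simp: less_Suc_eq) (auto simp: shear_mat_def L_def)
  qed (use A in \<open>simp_all add: shear_mat_def L_def\<close>)
  have "Determinant.det A = Determinant.det L"
    by (simp add: A_eq det_mult[OF shear_mat_carrier L] det_shear_mat)
  moreover have zero: "L $$ (i, n) = 0" if "i < n" for i
    using that pivot by (simp add: L_def b_def)
  ultimately have "Determinant.det (mat_delete L n n) \<noteq> 0"
    using det det_last_column_zero[OF L] by auto
  then have "mat_scales n (mat_delete L n n)"
    using L by (intro IH) (auto simp: mat_delete_def)
  then have "mat_scales (Suc n) L"
    using pivot by (intro mat_scales_lower[OF L zero]) (auto simp: L_def)
  then show ?thesis
    unfolding A_eq by (intro mat_scales_mult shear_mat_carrier L mat_scales_shear)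
qed

text \<open>Induction on the dimension. A vanishing pivot is repaired by adding a suitable row to
  the last one, and the row addition itself is a matrix with nonzero pivot.\<close>

lemma mat_scales_invertible:
  "A \<in> carrier_mat n n \<Longrightarrow> Determinant.det A \<noteq> 0 \<Longrightarrow> mat_scales n A"
proof (induction n arbitrary: A)
  case 0
  have "mat_apply 0 A x = x" if "x \<in> space (borel_Rn 0)" for x
    using that by (auto simp: mat_apply_def space_borel_Rn Rn_def)
  then have "(\<integral>\<^sup>+x. F (mat_apply 0 A x) \<partial>borel_Rn 0) = (\<integral>\<^sup>+x. F x \<partial>borel_Rn 0)" for F
    by (intro nn_integral_cong) simp
  then show ?case
    using 0 by (simp add: mat_scales_def det_dim_zero)
next
  case (Suc n)
  note A = Suc.prems(1)
  show ?case
  proof (cases "A $$ (n, n) = 0")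
    case False
    with Suc show ?thesis by (intro mat_scales_Suc_pivot) auto
  next
    case True
    \<comment> \<open>If the whole last column vanished, so would the determinant.\<close>
    obtain i where i: "i < n" "A $$ (i, n) \<noteq> 0"
      using True Suc.prems(2) det_last_column_zero[OF A] by force
    \<comment> \<open>\<open>E a\<close> adds \<open>a\<close> times row \<open>i\<close> to the
      last row, so \<open>E (- 1)\<close> undoes \<open>E 1\<close>.\<close>
    define E where "E a = addrow_mat (Suc n) a n i" for a :: real
    have E: "E a \<in> carrier_mat (Suc n) (Suc n)" for a
      by (simp add: E_def)
    have detE: "Determinant.det (E a) = 1" for a
      using i by (simp add: E_def det_addrow_mat)
    have EA: "E a * A = addrow a n i A" for a
      using addrow_mat[OF A] i by (simp add: E_def)
    have "A = E (- 1) * (E 1 * A)"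
    proof -
      have "E 1 * A \<in> carrier_mat (Suc n) (Suc n)"
        using E A by (rule mult_carrier_mat)
      then have "E (- 1) * (E 1 * A) = addrow (- 1) n i (E 1 * A)"
        using addrow_mat[of "E 1 * A" "Suc n" "Suc n" i "- 1" n] i by (simp add: E_def)
      also have "\<dots> = addrow (- 1) n i (addrow 1 n i A)"
        by (simp only: EA)
      also have "\<dots> = A"
        using A i by (intro eq_matI) auto
      finally show ?thesis by simp
    qed
    moreover have "mat_scales (Suc n) (E 1 * A)"
    proof (rule mat_scales_Suc_pivot[OF Suc.IH])
      show "E 1 * A \<in> carrier_mat (Suc n) (Suc n)"
        using E A by (rule mult_carrier_mat)
      show "Determinant.det (E 1 * A) \<noteq> 0"
        using Suc.prems det_mult[OF E A] detE by simp
      show "(E 1 * A) $$ (n, n) \<noteq> 0"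
        using A i True by (simp add: EA)
    qed
    \<comment> \<open>The last diagonal entry of \<open>E (- 1)\<close> is 1, since \<open>i\<close>
      differs from \<open>n\<close>.\<close>
    moreover have "mat_scales (Suc n) (E (- 1))"
      using i E by (intro mat_scales_Suc_pivot[OF Suc.IH]) (auto simp: detE, simp add: E_def)
    ultimately show ?thesis
      using mat_scales_mult[OF E mult_carrier_mat[OF E A]] by metis
  qed
qed

section \<open>From matrices to linear operators\<close>

lemma linear_operator_eq_mat_apply:
  assumes T: "linear_operator n T" and x: "x \<in> Rn n"
  shows "T x = mat_apply n (Matrix.mat n n (\<lambda>(i, k). T (std_basis n k) i)) x"
proof -
  have add: "T (\<lambda>i\<in>{..<n}. u i + v i) = (\<lambda>i\<in>{..<n}. T u i + T v i)" if "u \<in> Rn n" "v \<in> Rn n" for u v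
    using T that by (simp add: linear_operator_def)
  have scale: "T (\<lambda>i\<in>{..<n}. c * u i) = (\<lambda>i\<in>{..<n}. c * T u i)" if "u \<in> Rn n" for c u
    using T that by (simp add: linear_operator_def)
  have basis: "std_basis n k \<in> Rn n" for k
    by (auto simp: std_basis_def Rn_def)
  \<comment> \<open>Additivity concerns two summands, so the expansion of \<open>x\<close> in the
    standard basis is built up one coordinate at a time through truncations of
    \<open>x\<close>.\<close>
  have partial: "T (\<lambda>i\<in>{..<n}. if i < k then x i else 0)
      = (\<lambda>i\<in>{..<n}. \<Sum>j<k. x j * T (std_basis n j) i)" for k
  proof (induction k)
    case 0
    \<comment> \<open>\<open>T\<close> fixes the zero vector, by homogeneity with scalar 0.\<close>
    then show ?case using scale[OF x, of 0] by (simp add: restrict_def)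
  next
    case (Suc k)
    have split: "(\<lambda>i\<in>{..<n}. if i < Suc k then x i else 0) = (\<lambda>i\<in>{..<n}.
        (\<lambda>i\<in>{..<n}. if i < k then x i else 0) i + (\<lambda>i\<in>{..<n}. x k * std_basis n k i) i)"
      by (auto simp: fun_eq_iff std_basis_def less_Suc_eq)
    have "T (\<lambda>i\<in>{..<n}. if i < Suc k then x i else 0) = (\<lambda>i\<in>{..<n}.
        T (\<lambda>i\<in>{..<n}. if i < k then x i else 0) i + T (\<lambda>i\<in>{..<n}. x k * std_basis n k i) i)"
      unfolding split
      by (rule add; unfold Rn_def, intro restrict_PiE_iff[THEN iffD2] ballI UNIV_I)
    also have "\<dots> = (\<lambda>i\<in>{..<n}. \<Sum>j<Suc k. x j * T (std_basis n j) i)"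
      unfolding Suc.IH scale[OF basis] by (rule restrict_ext) simp
    finally show ?case .
  qed
  have "(\<lambda>i\<in>{..<n}. if i < n then x i else 0) = x"
    using x by (auto simp: fun_eq_iff Rn_def PiE_def extensional_def)
  then have "T x = (\<lambda>i\<in>{..<n}. \<Sum>j<n. x j * T (std_basis n j) i)"
    using partial[of n] by simp
  also have "\<dots> = mat_apply n (Matrix.mat n n (\<lambda>(i, k). T (std_basis n k) i)) x"
    unfolding mat_apply_def by (intro restrict_ext sum.cong) auto
  finally show ?thesis .
qed

text \<open>The change of variables formula for indicator functions, divided by the absolute
  determinant.\<close>

lemma distr_mat_apply:
  assumes A: "A \<in> carrier_mat n n" and det: "Determinant.det A \<noteq> 0"
  shows "distr (borel_Rn n) (borel_Rn n) (mat_apply n A)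
    = scale_measure (ennreal (1 / \<bar>Determinant.det A\<bar>)) (borel_Rn n)"
proof (rule measure_eqI)
  fix X assume "X \<in> sets (distr (borel_Rn n) (borel_Rn n) (mat_apply n A))"
  then have X: "X \<in> sets (borel_Rn n)" by simp
  have "(\<integral>\<^sup>+x. indicator X (mat_apply n A x) \<partial>borel_Rn n)
      = (\<integral>\<^sup>+x. indicator X x \<partial>distr (borel_Rn n) (borel_Rn n) (mat_apply n A))"
    using X by (intro nn_integral_distr[symmetric] mat_apply_measurable) auto
  then have "ennreal \<bar>Determinant.det A\<bar> * emeasure (distr (borel_Rn n) (borel_Rn n) (mat_apply n A)) X
      = emeasure (borel_Rn n) X"
    using bspec[OF mat_scales_invertible[OF A det, unfolded mat_scales_def], of "indicator X"] X
    by simp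
  then show "emeasure (distr (borel_Rn n) (borel_Rn n) (mat_apply n A)) X
      = emeasure (scale_measure (ennreal (1 / \<bar>Determinant.det A\<bar>)) (borel_Rn n)) X"
    using det ennreal_inverse_cancel(1)[of "\<bar>Determinant.det A\<bar>"] by (metis emeasure_scale_measure zero_less_abs_iff)
qed simp

lemma invertible_linear_operator:
  assumes T: "linear_operator n T" and det: "det_operator n T \<noteq> 0"
  obtains S where "T \<in> borel_Rn n \<rightarrow>\<^sub>M borel_Rn n" "S \<in> borel_Rn n \<rightarrow>\<^sub>M borel_Rn n"
    "\<And>x. x \<in> Rn n \<Longrightarrow> S (T x) = x" "\<And>x. x \<in> Rn n \<Longrightarrow> T (S x) = x"
    "distr (borel_Rn n) (borel_Rn n) T = scale_measure (ennreal (1 / \<bar>det_operator n T\<bar>)) (borel_Rn n)"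
proof -
  define A where "A = Matrix.mat n n (\<lambda>(i, k). T (std_basis n k) i)"
  have A: "A \<in> carrier_mat n n" by (simp add: A_def)
  have detA: "Determinant.det A = det_operator n T" by (simp add: A_def det_operator_def)
  have T_eq: "T x = mat_apply n A x" if "x \<in> Rn n" for x
    using linear_operator_eq_mat_apply[OF T that] by (simp add: A_def)
  \<comment> \<open>A nonzero determinant makes \<open>A\<close> a unit of the matrix ring;
    \<open>undefined\<close> instantiates the record extension of \<open>ring_mat\<close>.\<close>
  obtain B where B: "B \<in> carrier_mat n n" "A * B = 1\<^sub>m n" "B * A = 1\<^sub>m n"
    using det_non_zero_imp_unit[OF A, of undefined] det detA
    by (auto simp: Units_def ring_mat_def)
  show thesis
  proof
    show "T \<in> borel_Rn n \<rightarrow>\<^sub>M borel_Rn n"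
      using mat_apply_measurable[of n A] by (subst measurable_cong[OF T_eq]) (auto simp: space_borel_Rn)
    show "mat_apply n B \<in> borel_Rn n \<rightarrow>\<^sub>M borel_Rn n"
      by (rule mat_apply_measurable)
    show "mat_apply n B (T x) = x" if "x \<in> Rn n" for x
      using that by (simp add: T_eq mat_apply_mult[OF B(1) A, symmetric] B mat_apply_one)
    show "T (mat_apply n B x) = x" if "x \<in> Rn n" for x
      using that by (simp add: T_eq mat_apply_in_Rn mat_apply_mult[OF A B(1), symmetric] B mat_apply_one)
    have "distr (borel_Rn n) (borel_Rn n) T = distr (borel_Rn n) (borel_Rn n) (mat_apply n A)"
      by (rule distr_cong) (auto simp: space_borel_Rn T_eq)
    also have "\<dots> = scale_measure (ennreal (1 / \<bar>det_operator n T\<bar>)) (borel_Rn n)"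
      using distr_mat_apply[OF A] det by (simp add: detA)
    finally show "distr (borel_Rn n) (borel_Rn n) T
        = scale_measure (ennreal (1 / \<bar>det_operator n T\<bar>)) (borel_Rn n)" .
  qed
qed

text \<open>The pushforward under \<open>T\<close> is the measure divided by the absolute
  determinant, so \<open>c\<close> is its reciprocal and \<open>c powr recip p\<close> is the
  claimed constant.\<close>

lemma Lp_norm_linear_operator:
  assumes T: "linear_operator n T" and det: "det_operator n T \<noteq> 0" and p: "p \<ge> 1"
  shows "Lp_norm (lebesgue_Rn n) p (\<lambda>t. F (T t))
    = ennreal (\<bar>det_operator n T\<bar> powr (- recip p)) * Lp_norm (lebesgue_Rn n) p F"
proof -
  define c where "c = 1 / \<bar>det_operator n T\<bar>"
  have c: "c > 0" using det by (simp add: c_def)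
  obtain S where ST: "T \<in> borel_Rn n \<rightarrow>\<^sub>M borel_Rn n" "S \<in> borel_Rn n \<rightarrow>\<^sub>M borel_Rn n"
    "\<And>x. x \<in> space (borel_Rn n) \<Longrightarrow> S (T x) = x" "\<And>x. x \<in> space (borel_Rn n) \<Longrightarrow> T (S x) = x"
    "distr (borel_Rn n) (borel_Rn n) T = scale_measure (ennreal c) (borel_Rn n)"
    using invertible_linear_operator[OF T det] unfolding c_def space_borel_Rn by blast
  \<comment> \<open>The inverse must also pass to the completion, which needs its own scaling
    factor.\<close>
  have S: "distr (borel_Rn n) (borel_Rn n) S = scale_measure (ennreal (1 / c)) (borel_Rn n)"
    using scaling_map_inverse[OF ST(1-3,5) c] .
  have "Lp_norm (lebesgue_Rn n) p (\<lambda>t. F (T t)) = ennreal (c powr recip p) * Lp_norm (lebesgue_Rn n) p F"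
    unfolding lebesgue_Rn_def
    using ST c p completion_of_scaling_map[OF ST(1,5)] completion_of_scaling_map[OF ST(2) S]
    by (intro Lp_norm_scaling_map[where S = S]) simp_all
  moreover have "c powr recip p = \<bar>det_operator n T\<bar> powr (- recip p)"
    by (simp add: c_def powr_minus powr_divide inverse_eq_divide)
  ultimately show ?thesis by simp
qed

section \<open>Mixed norms\<close>

text \<open>The blocks below \<open>k\<close> are overwritten by the variables of
  integration.\<close>

lemma iterated_norm_cong:
  "(\<And>j. j \<ge> k \<Longrightarrow> x j = y j) \<Longrightarrow> iterated_norm m p f k x = iterated_norm m p f k y"
proof (induction k arbitrary: x y)
  case 0
  then have "x = y" by (simp add: fun_eq_iff)
  then show ?case by simp
next
  case (Suc k)
  have "iterated_norm m p f k (x(k := t)) = iterated_norm m p f k (y(k := t))" for t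
    by (rule Suc.IH) (use Suc.prems in auto)
  then show ?case by simp
qed

text \<open>Each block norm, from the innermost outwards, contributes its own determinant factor.
  The blocks not yet integrated stay dilated, which is why the right side is taken at the dilated
  point.\<close>

lemma iterated_norm_dilation:
  assumes p: "\<And>j. j < l \<Longrightarrow> p j \<ge> 1"
    and lin: "\<And>j. j < l \<Longrightarrow> linear_operator (m j) (A j)"
    and det: "\<And>j. j < l \<Longrightarrow> det_operator (m j) (A j) \<noteq> 0"
  shows "k \<le> l \<Longrightarrow> iterated_norm m p (dilation l A f) k x
    = ennreal (dilation_const k m p A) * iterated_norm m p f k (\<lambda>j\<in>{..<l}. A j (x j))"
proof (induction k arbitrary: x)
  case 0
  then show ?case by (simp add: dilation_def dilation_const_def restrict_def)
next
  case (Suc k)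
  then have k: "k < l" by simp
  define y where "y = (\<lambda>j\<in>{..<l}. A j (x j))"
  \<comment> \<open>Inserting \<open>t\<close> in block \<open>k\<close> before dilating is
    inserting \<open>A k t\<close> afterwards, so the inner norm depends on \<open>t\<close> through
    \<open>A k t\<close> alone.\<close>
  have upd: "(\<lambda>j\<in>{..<l}. A j ((x(k := t)) j)) = y(k := A k t)" for t
    using k by (auto simp: y_def fun_eq_iff)
  have nonneg: "dilation_const k m p A \<ge> 0"
    unfolding dilation_const_def by (intro prod_nonneg) simp
  have "iterated_norm m p (dilation l A f) (Suc k) x
      = Lp_norm (lebesgue_Rn (m k)) (p k)
          (\<lambda>t. ennreal (dilation_const k m p A) * iterated_norm m p f k (y(k := A k t)))"
    using k by (simp only: iterated_norm.simps Suc.IH less_imp_le upd)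
  also have "\<dots> = ennreal (dilation_const k m p A) *
      Lp_norm (lebesgue_Rn (m k)) (p k) (\<lambda>t. iterated_norm m p f k (y(k := A k t)))"
    using nonneg p[OF k] by (rule Lp_norm_cmult)
  also have "\<dots> = ennreal (dilation_const k m p A) * (ennreal (\<bar>det_operator (m k) (A k)\<bar> powr (- recip (p k))) *
      iterated_norm m p f (Suc k) y)"
    by (simp only: iterated_norm.simps Lp_norm_linear_operator[OF lin[OF k] det[OF k] p[OF k],
        of "\<lambda>s. iterated_norm m p f k (y(k := s))"])
  also have "\<dots> = ennreal (dilation_const (Suc k) m p A) * iterated_norm m p f (Suc k) y"
    using nonneg by (simp add: dilation_const_def ennreal_mult mult.assoc del: iterated_norm.simps)
  finally show ?case unfolding y_def .
qed

lemma mixed_norm_dilation: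
  assumes "\<And>j. j < l \<Longrightarrow> p j \<ge> 1"
    and "\<And>j. j < l \<Longrightarrow> linear_operator (m j) (A j)"
    and "\<And>j. j < l \<Longrightarrow> det_operator (m j) (A j) \<noteq> 0"
  shows "mixed_norm l m p (dilation l A f) = ennreal (dilation_const l m p A) * mixed_norm l m p f"
  unfolding mixed_norm_def
  \<comment> \<open>Dilating the start point changes it at most in the blocks below
    \<open>l\<close>, all of which have been integrated out.\<close>
  by (subst iterated_norm_dilation[where l = l])
    (use assms in \<open>auto intro!: arg_cong2[where f = "(*)"] iterated_norm_cong\<close>)

section \<open>Measurability on the completed product\<close>

lemma product_sigma_finite_borel_Rn: "product_sigma_finite (\<lambda>j. borel_Rn (m j))"
  unfolding product_sigma_finite_def borel_Rn_def by (auto intro: lborel_prod.sigma_finite)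

text \<open>Besides Borel measurability, null sets must pull back to null sets. Comparing measures
  of boxes shows that the pushforward of the product measure is its multiple by
  \<open>1 / D\<close>, so \<open>completion_of_scaling_map\<close> applies.\<close>

lemma dilation_map_measurable:
  assumes lin: "\<And>j. j < l \<Longrightarrow> linear_operator (m j) (A j)"
    and det: "\<And>j. j < l \<Longrightarrow> det_operator (m j) (A j) \<noteq> 0"
  shows "(\<lambda>x. \<lambda>j\<in>{..<l}. A j (x j)) \<in> lebesgue_blocks l m \<rightarrow>\<^sub>M lebesgue_blocks l m"
proof -
  interpret product_sigma_finite "\<lambda>j. borel_Rn (m j)" by (rule product_sigma_finite_borel_Rn)
  define P where "P = (\<Pi>\<^sub>M j\<in>{..<l}. borel_Rn (m j))"
  define B where "B x = (\<lambda>j\<in>{..<l}. A j (x j))" for x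
  define d where "d j = \<bar>det_operator (m j) (A j)\<bar>" for j
  define D where "D = (\<Prod>j<l. d j)"
  have D: "D > 0"
    unfolding D_def d_def using det by (intro prod_pos) auto
  have A: "A j \<in> borel_Rn (m j) \<rightarrow>\<^sub>M borel_Rn (m j)"
    and scal: "distr (borel_Rn (m j)) (borel_Rn (m j)) (A j) = scale_measure (ennreal (1 / d j)) (borel_Rn (m j))"
    if "j < l" for j
    using invertible_linear_operator[OF lin[OF that] det[OF that]] unfolding d_def by blast+
  have B: "B \<in> P \<rightarrow>\<^sub>M P"
    unfolding B_def P_def
    by (intro measurable_restrict measurable_compose[OF measurable_component_singleton] A) auto
  \<comment> \<open>The factor \<open>D\<close> is put on the pushforward because
    \<open>PiM_eqI\<close> characterises the unscaled product measure by its values on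
    boxes.\<close>
  have "scale_measure (ennreal D) (distr P P B) = P"
    unfolding P_def
  proof (rule PiM_eqI)
    fix X assume X: "\<And>j. j \<in> {..<l} \<Longrightarrow> X j \<in> sets (borel_Rn (m j))"
    have pre: "B -` Pi\<^sub>E {..<l} X \<inter> space P = Pi\<^sub>E {..<l} (\<lambda>j. A j -` X j \<inter> space (borel_Rn (m j)))"
      by (auto simp: B_def P_def space_PiM PiE_iff extensional_def)
    have "emeasure (distr P P B) (Pi\<^sub>E {..<l} X) = emeasure P (B -` Pi\<^sub>E {..<l} X \<inter> space P)"
      using B X by (intro emeasure_distr) (auto simp: P_def)
    also have "\<dots> = (\<Prod>j<l. emeasure (borel_Rn (m j)) (A j -` X j \<inter> space (borel_Rn (m j))))"
      unfolding pre unfolding P_def using A X by (intro emeasure_PiM) (auto intro: measurable_sets)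
    also have "\<dots> = (\<Prod>j<l. ennreal (1 / d j) * emeasure (borel_Rn (m j)) (X j))"
    proof (rule prod.cong)
      fix j assume "j \<in> {..<l}"
      then have "emeasure (distr (borel_Rn (m j)) (borel_Rn (m j)) (A j)) (X j)
          = emeasure (borel_Rn (m j)) (A j -` X j \<inter> space (borel_Rn (m j)))"
        by (intro emeasure_distr A X) simp_all
      with \<open>j \<in> {..<l}\<close> show "emeasure (borel_Rn (m j)) (A j -` X j \<inter> space (borel_Rn (m j)))
          = ennreal (1 / d j) * emeasure (borel_Rn (m j)) (X j)"
        by (simp only: scal lessThan_iff emeasure_scale_measure)
    qed simp
    finally have "emeasure (scale_measure (ennreal D) (distr P P B)) (Pi\<^sub>E {..<l} X)
        = (\<Prod>j<l. ennreal (d j) * (ennreal (1 / d j) * emeasure (borel_Rn (m j)) (X j)))"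
      by (simp add: D_def d_def prod.distrib prod_ennreal)
    also have "\<dots> = (\<Prod>j<l. emeasure (borel_Rn (m j)) (X j))"
      using det by (intro prod.cong) (auto simp: d_def ennreal_inverse_cancel)
    finally show "emeasure (scale_measure (ennreal D) (distr (Pi\<^sub>M {..<l} (\<lambda>j. borel_Rn (m j)))
          (Pi\<^sub>M {..<l} (\<lambda>j. borel_Rn (m j))) B)) (Pi\<^sub>E {..<l} X)
        = (\<Prod>j<l. emeasure (borel_Rn (m j)) (X j))"
      unfolding P_def .
  qed simp_all
  then have "scale_measure (ennreal (1 / D)) P = scale_measure (ennreal (1 / D) * ennreal D) (distr P P B)"
    by (metis scale_scale_measure)
  also have "\<dots> = distr P P B"
    using ennreal_inverse_cancel(1)[OF D, of 1] by simp
  finally have "distr P P B = scale_measure (ennreal (1 / D)) P" ..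
  then have "B \<in> completion P \<rightarrow>\<^sub>M completion P"
    using D by (intro completion_of_scaling_map(1)[OF B]) auto
  then show ?thesis
    unfolding lebesgue_blocks_def P_def B_def .
qed

text \<open>A null set of one block pulls back to a box with a null side, and the zero factor
  annihilates the product even when other factors are infinite. This makes factors that are only
  Lebesgue measurable measurable on the whole space.\<close>

lemma component_measurable_lebesgue_blocks:
  assumes j: "j < l"
  shows "(\<lambda>x. x j) \<in> lebesgue_blocks l m \<rightarrow>\<^sub>M lebesgue_Rn (m j)"
proof -
  interpret product_sigma_finite "\<lambda>j. borel_Rn (m j)" by (rule product_sigma_finite_borel_Rn)
  define P where "P = (\<Pi>\<^sub>M j\<in>{..<l}. borel_Rn (m j))"
  have comp: "(\<lambda>x. x j) \<in> P \<rightarrow>\<^sub>M borel_Rn (m j)"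
    using j by (auto simp: P_def)
  have "emeasure P ((\<lambda>x. x j) -` N \<inter> space P) = 0" if N: "N \<in> null_sets (borel_Rn (m j))" for N
  proof -
    let ?X = "\<lambda>i. if i = j then N else space (borel_Rn (m i))"
    have "(\<lambda>x. x j) -` N \<inter> space P = Pi\<^sub>E {..<l} ?X"
      using j sets.sets_into_space[OF null_setsD2[OF N]]
      by (auto simp: P_def space_PiM PiE_iff Ball_def split: if_splits) blast
    also have "emeasure P \<dots> = (\<Prod>i<l. emeasure (borel_Rn (m i)) (?X i))"
      unfolding P_def using N by (intro emeasure_PiM) auto
    also have "\<dots> = 0"
      using N j by (intro prod_zero) auto
    finally show ?thesis .
  qed
  then have "null_sets (borel_Rn (m j)) \<subseteq> null_sets (distr (completion P) (borel_Rn (m j)) (\<lambda>x. x j))"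
    using comp by (auto simp: distr_completion null_sets_def emeasure_distr)
  then show ?thesis
    unfolding lebesgue_blocks_def lebesgue_Rn_def
    using measurable_completion[OF comp] by (intro completion.measurable_completion2) (simp_all add: P_def)
qed

lemma iterated_norm_factorable:
  assumes p: "\<And>j. j < l \<Longrightarrow> p j \<ge> 1"
    and c: "\<And>j. j < l \<Longrightarrow> Lp_norm (lebesgue_Rn (m j)) (p j) (\<lambda>t. ennreal \<bar>g j t\<bar>) = ennreal (c j)"
    and c_nonneg: "\<And>j. j < l \<Longrightarrow> c j \<ge> 0"
    and f: "\<And>x. x \<in> (\<Pi>\<^sub>E j\<in>{..<l}. Rn (m j)) \<Longrightarrow> f x = (\<Prod>j<l. g j (x j))"
  shows "k \<le> l \<Longrightarrow> (\<And>j. k \<le> j \<Longrightarrow> j < l \<Longrightarrow> x j \<in> Rn (m j)) \<Longrightarrow> (\<And>j. j \<ge> l \<Longrightarrow> x j = undefined) \<Longrightarrow>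
    iterated_norm m p f k x = ennreal ((\<Prod>j<k. c j) * (\<Prod>j=k..<l. \<bar>g j (x j)\<bar>))"
proof (induction k arbitrary: x)
  case 0
  then have "x \<in> (\<Pi>\<^sub>E j\<in>{..<l}. Rn (m j))"
    by (auto simp: PiE_iff extensional_def)
  then show ?case
    by (simp add: f abs_prod lessThan_atLeast0)
next
  case (Suc k)
  then have k: "k < l" by simp
  \<comment> \<open>\<open>D\<close> collects all factors that are constant in block
    \<open>k\<close>, to be pulled out of its norm.\<close>
  define D where "D = (\<Prod>j<k. c j) * (\<Prod>j=Suc k..<l. \<bar>g j (x j)\<bar>)"
  have D: "D \<ge> 0"
    unfolding D_def using k c_nonneg by (intro mult_nonneg_nonneg prod_nonneg) auto
  have "iterated_norm m p f (Suc k) x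
      = Lp_norm (lebesgue_Rn (m k)) (p k) (\<lambda>t. ennreal D * ennreal \<bar>g k t\<bar>)"
    unfolding iterated_norm.simps
  proof (rule Lp_norm_cong_space)
    fix t assume "t \<in> space (lebesgue_Rn (m k))"
    then have "t \<in> Rn (m k)"
      by (simp add: lebesgue_Rn_def space_borel_Rn)
    then have "iterated_norm m p f k (x(k := t))
        = ennreal ((\<Prod>j<k. c j) * (\<Prod>j=k..<l. \<bar>g j ((x(k := t)) j)\<bar>))"
      using Suc.prems k by (intro Suc.IH) auto
    moreover have "(\<Prod>j=k..<l. \<bar>g j ((x(k := t)) j)\<bar>) = \<bar>g k t\<bar> * (\<Prod>j=Suc k..<l. \<bar>g j (x j)\<bar>)"
      using k by (simp add: prod.atLeast_Suc_lessThan)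
    ultimately show "iterated_norm m p f k (x(k := t)) = ennreal D * ennreal \<bar>g k t\<bar>"
      using D by (simp add: D_def ennreal_mult[symmetric] mult_ac)
  qed
  also have "\<dots> = ennreal D * ennreal (c k)"
    using D p[OF k] c[OF k] by (simp add: Lp_norm_cmult)
  also have "\<dots> = ennreal ((\<Prod>j<Suc k. c j) * (\<Prod>j=Suc k..<l. \<bar>g j (x j)\<bar>))"
    using D c_nonneg[OF k] by (simp add: D_def ennreal_mult[symmetric] mult_ac)
  finally show ?case .
qed

lemma factorable_in_mixed_Lp:
  assumes p: "\<And>j. j < l \<Longrightarrow> p j \<ge> 1" and "factorable l m p f"
  shows "f \<in> mixed_Lp l m p"
proof -
  obtain g where g: "\<And>j. j < l \<Longrightarrow> g j \<in> Lp (m j) (p j)"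
    and f: "\<And>x. x \<in> (\<Pi>\<^sub>E j\<in>{..<l}. Rn (m j)) \<Longrightarrow> f x = (\<Prod>j<l. g j (x j))"
    using assms(2) unfolding factorable_def by blast
  define c where "c j = enn2real (Lp_norm (lebesgue_Rn (m j)) (p j) (\<lambda>t. ennreal \<bar>g j t\<bar>))" for j
  have c: "Lp_norm (lebesgue_Rn (m j)) (p j) (\<lambda>t. ennreal \<bar>g j t\<bar>) = ennreal (c j)" if "j < l" for j
    using g[OF that] by (simp add: c_def Lp_def less_top)
  \<comment> \<open>At \<open>k = l\<close> the membership condition on the blocks is vacuous, the
    start point is \<open>undefined\<close> from block \<open>l\<close> on, and the second product
    is empty.\<close>
  have "mixed_norm l m p f = ennreal ((\<Prod>j<l. c j) * (\<Prod>j=l..<l. \<bar>g j undefined\<bar>))"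
    unfolding mixed_norm_def by (rule iterated_norm_factorable[OF p c _ f]) (auto simp: c_def)
  moreover have "f \<in> borel_measurable (lebesgue_blocks l m)"
  proof -
    have "(\<lambda>x. \<Prod>j<l. g j (x j)) \<in> borel_measurable (lebesgue_blocks l m)"
      using g by (intro borel_measurable_prod measurable_compose[OF component_measurable_lebesgue_blocks])
        (auto simp: Lp_def)
    then show ?thesis
      by (subst measurable_cong[OF f]) (auto simp: lebesgue_blocks_def space_PiM space_borel_Rn)
  qed
  ultimately show ?thesis
    by (simp add: mixed_Lp_def)
qed

lemma dilation_in_mixed_Lp:
  assumes "\<And>j. j < l \<Longrightarrow> p j \<ge> 1"
    and lin: "\<And>j. j < l \<Longrightarrow> linear_operator (m j) (A j)"
    and det: "\<And>j. j < l \<Longrightarrow> det_operator (m j) (A j) \<noteq> 0"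
    and f: "f \<in> mixed_Lp l m p"
  shows "dilation l A f \<in> mixed_Lp l m p"
proof -
  have "dilation l A f \<in> borel_measurable (lebesgue_blocks l m)"
    unfolding dilation_def[abs_def] using f
    by (intro measurable_compose[OF dilation_map_measurable[where A = A and m = m, OF lin det]])
      (auto simp: mixed_Lp_def)
  moreover have "mixed_norm l m p (dilation l A f) < \<infinity>"
    using f mixed_norm_dilation[where A = A and m = m, OF assms(1-3)]
    by (simp add: mixed_Lp_def ennreal_mult_less_top)
  ultimately show ?thesis
    by (simp add: mixed_Lp_def)
qed

theorem proposition5p1:
  fixes l d :: nat and m :: "nat \<Rightarrow> nat" and p :: "nat \<Rightarrow> ennreal"
    and A :: "nat \<Rightarrow> (nat \<Rightarrow> real) \<Rightarrow> (nat \<Rightarrow> real)"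
  assumes "l \<ge> 1"
    and "\<And>j. j < l \<Longrightarrow> m j \<ge> 1"
    and "(\<Sum>j<l. m j) = d"
    and "\<And>j. j < l \<Longrightarrow> p j \<ge> 1"
    and "\<And>j. j < l \<Longrightarrow> linear_operator (m j) (A j)"
    and "\<And>j. j < l \<Longrightarrow> det_operator (m j) (A j) \<noteq> 0"
  shows "(\<forall>f \<in> mixed_Lp l m p.
            dilation l A f \<in> mixed_Lp l m p \<and>
            mixed_norm l m p (dilation l A f)
              \<le> ennreal (dilation_const l m p A) * mixed_norm l m p f) \<and>
         (\<forall>f. factorable l m p f \<longrightarrow>
            f \<in> mixed_Lp l m p \<and>
            mixed_norm l m p (dilation l A f)
              = ennreal (dilation_const l m p A) * mixed_norm l m p f)"
  using dilation_in_mixed_Lp[where A = A and m = m and p = p, OF assms(4-6)]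
    mixed_norm_dilation[where A = A and m = m and p = p, OF assms(4-6)]
    factorable_in_mixed_Lp[where p = p, OF assms(4)]
  by (intro conjI ballI allI impI) simp_all

end
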